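(* Let $H$ be a subgroup of a group $G$, and suppose that $G=HI$ for some finite subgroup $I$ of $G$ such that any two subgroups $I_1,I_2$ of $I$ are permutable, i.e., $I_1I_2=I_2I_1$. Then the pair $(G,H)$ has the Jordan property.
   Context: For subsets $X,Y$ of a group, $XY=\{xy: x\in X, y\in Y\}$. Let $H$ be a finite-index subgroup of a group $G$. The pair $(G,H)$ has the Jordan property when the following holds: if $A_1\subsetneq\dots\subsetneq A_a$ and $B_1\subsetneq\dots\subsetneq B_b$ are maximal chains of groups between $H$ and $G$ (inclusive, so that $A_1=B_1=H$ and $A_a=B_b=G$), then $a=b$ and the sequence $([A_2:A_1],\dots,[A_a:A_{a-1}])$ is a permutation of the sequence $([B_2:B_1],\dots,[B_b:B_{b-1}])$. (In the claim, $H$ automatically has finite index in $G$ because $I$ is finite.) *)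

theory Defs
  imports "HOL-Algebra.Coset" "HOL-Library.Multiset"
begin

definition intermediate_groups :: "('a, 'b) monoid_scheme \<Rightarrow> 'a set \<Rightarrow> 'a set set"
  where "intermediate_groups G H = {K. subgroup K G \<and> H \<subseteq> K}"

(* Junk value 0 when the index is infinite; below it is only used when it is finite. *)
definition subgroup_index :: "('a, 'b) monoid_scheme \<Rightarrow> 'a set \<Rightarrow> 'a set \<Rightarrow> nat"
  where "subgroup_index G B A = card (rcosets\<^bsub>G\<lparr>carrier := B\<rparr>\<^esub> A)"

(* A maximal chain, listed in increasing order. That the list starts with H and ends with
   carrier G is a consequence of maximality. *)
definition maximal_group_chain :: "('a, 'b) monoid_scheme \<Rightarrow> 'a set \<Rightarrow> 'a set list \<Rightarrow> bool"
  where "maximal_group_chain G H As \<longleftrightarrow>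
    sorted_wrt (\<subset>) As \<and> subset.maxchain (intermediate_groups G H) (set As)"

definition index_sequence :: "('a, 'b) monoid_scheme \<Rightarrow> 'a set list \<Rightarrow> nat list"
  where "index_sequence G As =
    map (\<lambda>i. subgroup_index G (As ! Suc i) (As ! i)) [0..<length As - 1]"

(* The property is only defined for subgroups of finite index, so this is part of the
   definition. All chains of intermediate groups are then finite, and lists suffice. *)
definition jordan_property :: "('a, 'b) monoid_scheme \<Rightarrow> 'a set \<Rightarrow> bool"
  where "jordan_property G H \<longleftrightarrow>
    subgroup H G \<and> finite (rcosets\<^bsub>G\<^esub> H) \<and>
    (\<forall>As Bs. maximal_group_chain G H As \<longrightarrow> maximal_group_chain G H Bs \<longrightarrow>
       length As = length Bs \<and> mset (index_sequence G As) = mset (index_sequence G Bs))"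

end

theory Submission
  imports Defs
begin

text \<open>
  Write \<open>L = K \<inter> I\<close> for a group \<open>K\<close> between \<open>H\<close> and \<open>G\<close>. Since \<open>G = H I\<close>, Dedekind's modular law
  gives \<open>K = H L = L H\<close>. For two such groups \<open>K\<^sub>1, K\<^sub>2\<close> the inclusion \<open>H \<subseteq> K\<^sub>2\<close> then yields
  \<open>K\<^sub>1 K\<^sub>2 = L\<^sub>1 H K\<^sub>2 = L\<^sub>1 K\<^sub>2 = L\<^sub>1 L\<^sub>2 H\<close>, so permutability of the subgroups of \<open>I\<close> passes to the
  intermediate groups. There are only finitely many of these, because \<open>K\<close> is determined by the
  subset \<open>L\<close> of the finite set \<open>I\<close>.

  Permutable groups behave as normal subgroups do in the Jordan--Hoelder theorem. If \<open>A \<noteq> B\<close> are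
  both maximal below \<open>K\<close>, then \<open>A B\<close> is a group, hence \<open>K = A B\<close>; the modular law shows that
  \<open>A \<inter> B\<close> is maximal below \<open>A\<close> and below \<open>B\<close>; and counting cosets gives
  \<open>[K : A] = [B : A \<inter> B]\<close> and \<open>[K : B] = [A : A \<inter> B]\<close>. Two maximal chains ending in \<open>A \<subset> K\<close> and
  in \<open>B \<subset> K\<close> are therefore compared, by induction on the length, with two chains that pass through
  a common chain up to \<open>A \<inter> B\<close> and differ only in swapping these two indices.
\<close>

section \<open>Maximal chains in a family of sets with exchange of weights\<close>

definition covers :: "'a set set \<Rightarrow> 'a set \<Rightarrow> 'a set \<Rightarrow> bool"
  where "covers S A B \<longleftrightarrow> A \<in> S \<and> B \<in> S \<and> A \<subset> B \<and> (\<forall>C\<in>S. A \<subseteq> C \<longrightarrow> C \<subseteq> B \<longrightarrow> C = A \<or> C = B)"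

text \<open>
  The multiset collects the weights of the steps of a chain of covers from \<open>H\<close> to \<open>K\<close>. Keeping the
  weights and forgetting the chain is enough: the length of the chain is the size of the multiset
  plus one.
\<close>

inductive chain_weights :: "'a set set \<Rightarrow> ('a set \<Rightarrow> 'a set \<Rightarrow> 'w) \<Rightarrow> 'a set \<Rightarrow> 'a set \<Rightarrow> 'w multiset \<Rightarrow> bool"
  for S w H where
  base: "H \<in> S \<Longrightarrow> chain_weights S w H H {#}"
| step: "chain_weights S w H A M \<Longrightarrow> covers S A K \<Longrightarrow> chain_weights S w H K (add_mset (w A K) M)"

lemma chain_weights_above: "chain_weights S w H K M \<Longrightarrow> H \<subseteq> K"
  by (induction rule: chain_weights.induct) (auto simp: covers_def)

lemma chain_weights_bottom: "chain_weights S w H H N \<Longrightarrow> N = {#}"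
  by (cases rule: chain_weights.cases, assumption)
    (use chain_weights_above in \<open>force simp: covers_def\<close>)+

lemma chain_weights_exists:
  assumes "finite S" and "H \<in> S" and least: "\<And>K. K \<in> S \<Longrightarrow> H \<subseteq> K" and "K \<in> S"
  shows "\<exists>M. chain_weights S w H K M"
  using \<open>K \<in> S\<close>
proof (induction "card {D \<in> S. D \<subset> K}" arbitrary: K rule: less_induct)
  case less
  show ?case
  proof (cases "K = H")
    case True
    then show ?thesis using chain_weights.base[OF \<open>H \<in> S\<close>] by blast
  next
    case False
    let ?B = "\<lambda>K. {D \<in> S. D \<subset> K}"
    have "finite (?B K)" and "H \<in> ?B K"
      using \<open>finite S\<close> \<open>H \<in> S\<close> False least[OF less.prems] by auto
    then obtain A where A: "A \<in> ?B K" and max: "\<forall>D \<in> ?B K. A \<le> D \<longrightarrow> A = D"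
      using finite_has_maximal[of "?B K"] by blast
    have "covers S A K"
      using A max less.prems unfolding covers_def by blast
    moreover have "card (?B A) < card (?B K)"
      using A by (intro psubset_card_mono \<open>finite (?B K)\<close>) auto
    then obtain M where "chain_weights S w H A M"
      using less.hyps[of A] A by blast
    ultimately show ?thesis
      using chain_weights.step by blast
  qed
qed

text \<open>
  If the chains end in \<open>A \<subset> K\<close> and \<open>B \<subset> K\<close>, then a chain to \<open>A \<inter> B\<close>, extended to \<open>A\<close> and to \<open>B\<close>, is
  compared with both. Induction on the length of the first chain covers both comparisons: the one at
  \<open>A\<close> fixes the length of the new chain, and so the one at \<open>B\<close> starts from a chain of that same length.
\<close>

lemma chain_weights_unique:
  assumes "finite S" and "H \<in> S" and least: "\<And>K. K \<in> S \<Longrightarrow> H \<subseteq> K"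
    and exchange: "\<And>A B K. covers S A K \<Longrightarrow> covers S B K \<Longrightarrow> A \<noteq> B \<Longrightarrow>
      covers S (A \<inter> B) B \<and> w A K = w (A \<inter> B) B"
    and "chain_weights S w H K M" and "chain_weights S w H K N"
  shows "M = N"
  using assms(5,6)
proof (induction "size M" arbitrary: K M N)
  case 0
  then have "K = H"
    by (auto elim: chain_weights.cases)
  with 0 show ?case
    using chain_weights_bottom[of S w H N] by simp
next
  case (Suc n)
  from Suc.prems(1) Suc.hyps(2) obtain A M' where A: "chain_weights S w H A M'" "covers S A K"
    and M: "M = add_mset (w A K) M'"
    by (auto elim: chain_weights.cases)
  have "K \<noteq> H"
    using A chain_weights_above[OF A(1)] by (auto simp: covers_def)
  with Suc.prems(2) obtain B N' where B: "chain_weights S w H B N'" "covers S B K"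
    and N: "N = add_mset (w B K) N'"
    by (blast elim: chain_weights.cases)
  have size: "size M' = n" using Suc.hyps(2) M by simp
  show ?case
  proof (cases "A = B")
    case True
    then show ?thesis using Suc.hyps(1)[of M' A N'] A B M N size by simp
  next
    case False
    have CB: "covers S (A \<inter> B) B" "w A K = w (A \<inter> B) B"
      using exchange[OF A(2) B(2) False] by auto
    have CA: "covers S (A \<inter> B) A" "w B K = w (A \<inter> B) A"
      using exchange[OF B(2) A(2)] False by (auto simp: Int_commute)
    have "A \<inter> B \<in> S" using CA(1) by (simp add: covers_def)
    from chain_weights_exists[OF assms(1,2) least this]
    obtain P where P: "chain_weights S w H (A \<inter> B) P" ..
    have "chain_weights S w H A (add_mset (w B K) P)"
      using chain_weights.step[OF P CA(1)] CA(2) by simp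
    from Suc.hyps(1)[OF size[symmetric] A(1) this] have M': "M' = add_mset (w B K) P" .
    have "chain_weights S w H B (add_mset (w A K) P)"
      using chain_weights.step[OF P CB(1)] CB(2) by simp
    moreover have "n = size (add_mset (w A K) P)"
      using size M' by simp
    ultimately have "add_mset (w A K) P = N'"
      using Suc.hyps(1) B(1) by blast
    then show ?thesis using M N M' by simp
  qed
qed

lemma maxchain_memberI:
  assumes "subset.maxchain S C" and "X \<in> S" and "\<And>Y. Y \<in> C \<Longrightarrow> Y \<subseteq> X \<or> X \<subseteq> Y"
  shows "X \<in> C"
proof (rule ccontr)
  assume "X \<notin> C"
  have "subset.chain S (insert X C)"
    using assms unfolding subset.maxchain_def subset_chain_def by blast
  with \<open>X \<notin> C\<close> assms(1) show False
    unfolding subset.maxchain_def by blast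
qed

lemma sorted_psubset_nth:
  assumes "sorted_wrt (\<subset>) As" and "j < length As"
  shows "i \<le> j \<Longrightarrow> As ! i \<subseteq> As ! j" and "i < j \<Longrightarrow> As ! i \<subset> As ! j"
proof -
  show "i < j \<Longrightarrow> As ! i \<subset> As ! j"
    using assms sorted_wrt_nth_less by blast
  then show "i \<le> j \<Longrightarrow> As ! i \<subseteq> As ! j"
    by (cases "i = j") auto
qed

text \<open>
  A member of \<open>S\<close> strictly between two consecutive entries would be comparable with the whole chain
  and could be added to it; the same holds for the least and the greatest member of \<open>S\<close>, so these
  are the ends of the list.
\<close>

lemma chain_weights_maxchain:
  assumes sorted: "sorted_wrt (\<subset>) As" and max: "subset.maxchain S (set As)"
    and "H \<in> S" and least: "\<And>K. K \<in> S \<Longrightarrow> H \<subseteq> K"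
    and "T \<in> S" and greatest: "\<And>K. K \<in> S \<Longrightarrow> K \<subseteq> T"
  shows "As \<noteq> []"
    and "chain_weights S w H T (mset (map (\<lambda>i. w (As ! i) (As ! Suc i)) [0..<length As - 1]))"
proof -
  note nth = sorted_psubset_nth[OF sorted]
  have sub: "set As \<subseteq> S"
    using max unfolding subset.maxchain_def subset_chain_def by blast
  have "H \<in> set As" and "T \<in> set As"
    using least greatest sub by (auto intro!: maxchain_memberI[OF max] \<open>H \<in> S\<close> \<open>T \<in> S\<close>)
  then show "As \<noteq> []" by auto
  then have first: "As ! 0 \<in> S" and last: "As ! (length As - 1) \<in> S"
    using sub by auto
  obtain h where h: "h < length As" "As ! h = H"
    using \<open>H \<in> set As\<close> by (auto simp: in_set_conv_nth)
  then have "As ! 0 = H"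
    using nth(1)[of h 0] least[OF first] by auto
  obtain t where t: "t < length As" "As ! t = T"
    using \<open>T \<in> set As\<close> by (auto simp: in_set_conv_nth)
  then have "As ! (length As - 1) = T"
    using nth(1)[of "length As - 1" t] greatest[OF last] by fastforce
  have cov: "covers S (As ! i) (As ! Suc i)" if i: "Suc i < length As" for i
    unfolding covers_def
  proof (intro conjI ballI impI)
    show "As ! i \<in> S" "As ! Suc i \<in> S"
      using sub i by (auto intro: subsetD[OF sub nth_mem])
    show "As ! i \<subset> As ! Suc i"
      using nth(2)[of "Suc i" i] i by simp
    fix C assume C: "C \<in> S" "As ! i \<subseteq> C" "C \<subseteq> As ! Suc i"
    have "C \<in> set As"
    proof (rule maxchain_memberI[OF max \<open>C \<in> S\<close>])
      fix Y assume "Y \<in> set As"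
      then obtain j where j: "j < length As" "As ! j = Y" by (auto simp: in_set_conv_nth)
      show "Y \<subseteq> C \<or> C \<subseteq> Y"
      proof (cases "j \<le> i")
        case True
        then show ?thesis using nth(1)[of i j] i j C by auto
      next
        case False
        then show ?thesis using nth(1)[of j "Suc i"] i j C by auto
      qed
    qed
    then obtain j where j: "j < length As" "As ! j = C" by (auto simp: in_set_conv_nth)
    have "\<not> j < i" using nth(2)[of i j] i j C by auto
    moreover have "\<not> Suc i < j" using nth(2)[of j "Suc i"] i j C by auto
    ultimately have "j = i \<or> j = Suc i" by linarith
    then show "C = As ! i \<or> C = As ! Suc i" using j by blast
  qed
  have "chain_weights S w H (As ! k) (mset (map (\<lambda>i. w (As ! i) (As ! Suc i)) [0..<k]))"
    if "k < length As" for k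
    using that
  proof (induction k)
    case 0
    then show ?case using chain_weights.base[OF \<open>H \<in> S\<close>] \<open>As ! 0 = H\<close> by simp
  next
    case (Suc k)
    then show ?case using chain_weights.step[OF Suc.IH cov[of k]] by simp
  qed
  from this[of "length As - 1"] show
    "chain_weights S w H T (mset (map (\<lambda>i. w (As ! i) (As ! Suc i)) [0..<length As - 1]))"
    using \<open>As \<noteq> []\<close> \<open>As ! (length As - 1) = T\<close> by simp
qed

section \<open>Products of subgroups\<close>

context group
begin

lemma set_multI: "a \<in> A \<Longrightarrow> b \<in> B \<Longrightarrow> a \<otimes> b \<in> A <#> B"
  by (auto simp: set_mult_def)

lemma set_multE:
  assumes "x \<in> A <#> B"
  obtains a b where "a \<in> A" "b \<in> B" "x = a \<otimes> b"
  using assms by (auto simp: set_mult_def)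

lemma subset_set_mult:
  assumes "subgroup A G" "subgroup B G"
  shows "A \<subseteq> A <#> B" "B \<subseteq> A <#> B"
proof -
  show "A \<subseteq> A <#> B"
    using set_multI[OF _ subgroup.one_closed[OF assms(2)], of _ A] subgroup.mem_carrier[OF assms(1)] by force
  show "B \<subseteq> A <#> B"
    using set_multI[OF subgroup.one_closed[OF assms(1)], of _ B] subgroup.mem_carrier[OF assms(2)] by force
qed

lemma set_mult_subgroup_subset:
  assumes "subgroup K G" "A \<subseteq> K" "B \<subseteq> K"
  shows "A <#> B \<subseteq> K"
  using assms by (auto simp: set_mult_def intro: subgroup.m_closed)

lemma set_mult_absorb:
  assumes "subgroup H G" "subgroup K G" "H \<subseteq> K"
  shows "H <#> K = K"
  using set_mult_subgroup_subset[OF assms(2,3) order_refl] subset_set_mult(2)[OF assms(1,2)] by auto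

lemma subgroup_set_mult_permutable:
  assumes A: "subgroup A G" and B: "subgroup B G" and perm: "A <#> B = B <#> A"
  shows "subgroup (A <#> B) G"
proof (rule subgroupI)
  note car = subgroup.mem_carrier[OF A] subgroup.mem_carrier[OF B]
  show "A <#> B \<subseteq> carrier G"
    using A B by (intro set_mult_closed subgroup.subset)
  show "A <#> B \<noteq> {}"
    using subset_set_mult(1)[OF A B] subgroup.one_closed[OF A] by auto
  fix x assume x: "x \<in> A <#> B"
  then obtain a b where ab: "a \<in> A" "b \<in> B" "x = a \<otimes> b" by (rule set_multE)
  then have "inv x = inv b \<otimes> inv a" by (simp add: car inv_mult_group)
  also have "\<dots> \<in> B <#> A"
    using ab A B by (intro set_multI) (auto simp: subgroup.m_inv_closed)
  finally show "inv x \<in> A <#> B" using perm by simp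
  fix y assume "y \<in> A <#> B"
  then obtain c d where cd: "c \<in> A" "d \<in> B" "y = c \<otimes> d" by (rule set_multE)
  have "b \<otimes> c \<in> A <#> B" using perm ab cd by (auto intro: set_multI)
  then obtain c' b' where bc: "c' \<in> A" "b' \<in> B" "b \<otimes> c = c' \<otimes> b'" by (rule set_multE)
  have "x \<otimes> y = a \<otimes> (b \<otimes> c) \<otimes> d" using ab cd by (simp add: car m_assoc)
  also have "\<dots> = (a \<otimes> c') \<otimes> (b' \<otimes> d)" using ab cd bc by (simp add: car m_assoc)
  also have "\<dots> \<in> A <#> B"
    using ab cd bc A B by (intro set_multI) (auto simp: subgroup.m_closed)
  finally show "x \<otimes> y \<in> A <#> B" .
qed

lemma dedekind_modular_law:
  assumes "subgroup K G" "A \<subseteq> K" "subgroup B G"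
  shows "K \<inter> (A <#> B) = A <#> (K \<inter> B)"
proof
  show "A <#> (K \<inter> B) \<subseteq> K \<inter> (A <#> B)"
    using assms by (auto simp: set_mult_def intro: subgroup.m_closed)
  show "K \<inter> (A <#> B) \<subseteq> A <#> (K \<inter> B)"
  proof
    fix x assume x: "x \<in> K \<inter> (A <#> B)"
    then obtain a b where ab: "a \<in> A" "b \<in> B" "x = a \<otimes> b" by (auto elim: set_multE)
    have car: "a \<in> carrier G" "b \<in> carrier G"
      using ab assms by (auto dest: subgroup.mem_carrier)
    have "b = inv a \<otimes> x" using ab car by (simp add: m_assoc[symmetric])
    also have "\<dots> \<in> K"
      using x ab assms(2) by (intro subgroup.m_closed subgroup.m_inv_closed assms(1)) auto
    finally have "b \<in> K" .
    then show "x \<in> A <#> (K \<inter> B)" using ab by (auto intro: set_multI)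
  qed
qed

lemma set_mult_subgroup_commute:
  assumes A: "subgroup A G" and B: "subgroup B G" and AB: "subgroup (A <#> B) G"
  shows "A <#> B = B <#> A"
proof
  show "B <#> A \<subseteq> A <#> B"
    using subset_set_mult[OF A B] by (intro set_mult_subgroup_subset[OF AB])
  show "A <#> B \<subseteq> B <#> A"
  proof
    fix x assume x: "x \<in> A <#> B"
    then have "inv x \<in> A <#> B" by (rule subgroup.m_inv_closed[OF AB])
    then obtain a b where ab: "a \<in> A" "b \<in> B" "inv x = a \<otimes> b" by (rule set_multE)
    have car: "a \<in> carrier G" "b \<in> carrier G" "x \<in> carrier G"
      using ab x A B AB by (auto dest: subgroup.mem_carrier)
    have "x = inv (a \<otimes> b)" using ab(3) car by (metis inv_inv)
    then have "x = inv b \<otimes> inv a" using car by (simp add: inv_mult_group)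
    then show "x \<in> B <#> A"
      using ab A B by (auto intro!: set_multI subgroup.m_inv_closed)
  qed
qed

text \<open>
  Intersecting with \<open>B\<close> maps the right cosets of \<open>A\<close> in \<open>A B\<close> bijectively to the right cosets of
  \<open>A \<inter> B\<close> in \<open>B\<close>: every coset of \<open>A\<close> in \<open>A B\<close> has the form \<open>A b\<close> with \<open>b \<in> B\<close>, and
  \<open>A b \<inter> B = (A \<inter> B) b\<close>.
\<close>

lemma subgroup_index_set_mult:
  assumes A: "subgroup A G" and B: "subgroup B G"
  shows "subgroup_index G (A <#> B) A = subgroup_index G B (A \<inter> B)"
proof -
  have AB: "subgroup (A \<inter> B) G" using A B by (rule subgroups_Inter_pair)
  note car = subgroup.mem_carrier[OF A] subgroup.mem_carrier[OF B]
  let ?X = "(\<lambda>b. A #> b) ` B"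
  have rcosets: "rcosets\<^bsub>G\<lparr>carrier := K\<rparr>\<^esub> C = (\<lambda>x. C #> x) ` K" for K C
    by (simp add: RCOSETS_def r_coset_def UNION_singleton_eq_range)
  have "A #> (a \<otimes> b) = A #> b" if "a \<in> A" "b \<in> B" for a b
    using coset_mult_assoc[of A a b] coset_join2[of a A] that A car subgroup.subset[OF A] by simp
  then have "(\<lambda>x. A #> x) ` (A <#> B) = ?X"
    using subset_set_mult(2)[OF A B] by (auto elim!: set_multE)
  then have X: "rcosets\<^bsub>G\<lparr>carrier := A <#> B\<rparr>\<^esub> A = ?X"
    using rcosets by metis
  have meet: "(A #> b) \<inter> B = (A \<inter> B) #> b" if b: "b \<in> B" for b
  proof
    show "(A \<inter> B) #> b \<subseteq> (A #> b) \<inter> B"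
      using b by (auto simp: r_coset_def intro: subgroup.m_closed[OF B])
    show "(A #> b) \<inter> B \<subseteq> (A \<inter> B) #> b"
    proof
      fix x assume x: "x \<in> (A #> b) \<inter> B"
      then obtain a where a: "a \<in> A" "x = a \<otimes> b" by (auto simp: r_coset_def)
      then have "a = x \<otimes> inv b" using b car by (simp add: m_assoc)
      also have "\<dots> \<in> B"
        using x b by (intro subgroup.m_closed[OF B] subgroup.m_inv_closed[OF B]) auto
      finally have "a \<in> B" .
      then show "x \<in> (A \<inter> B) #> b" using a by (auto simp: r_coset_def)
    qed
  qed
  have "rcosets\<^bsub>G\<lparr>carrier := B\<rparr>\<^esub> (A \<inter> B) = (\<lambda>b. (A \<inter> B) #> b) ` B"
    by (rule rcosets)
  also have "\<dots> = (\<lambda>Y. Y \<inter> B) ` ?X"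
    unfolding image_image by (intro image_cong refl meet[symmetric])
  finally have Y: "rcosets\<^bsub>G\<lparr>carrier := B\<rparr>\<^esub> (A \<inter> B) = (\<lambda>Y. Y \<inter> B) ` ?X" .
  have "inj_on (\<lambda>Y. Y \<inter> B) ?X"
  proof (rule inj_onI, clarify)
    fix b c assume bc: "b \<in> B" "c \<in> B" "(A #> b) \<inter> B = (A #> c) \<inter> B"
    then have "c \<in> A #> b" using rcos_self[OF car(2)[OF bc(2)] A] by blast
    then show "A #> b = A #> c" using repr_independence car bc A by blast
  qed
  then show ?thesis
    unfolding subgroup_index_def X Y by (simp add: card_image)
qed

section \<open>Pairwise permutable intermediate groups\<close>

text \<open>
  A group \<open>D\<close> between \<open>A \<inter> B\<close> and \<open>B\<close> is recovered from the product \<open>D A\<close>, since the modular law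
  gives \<open>B \<inter> D A = D (A \<inter> B) = D\<close>. As \<open>D A\<close> lies between \<open>A\<close> and \<open>K\<close>, there are only two choices.
\<close>

lemma permutable_exchange:
  assumes perm: "\<And>A B. A \<in> intermediate_groups G H \<Longrightarrow> B \<in> intermediate_groups G H \<Longrightarrow>
      A <#> B = B <#> A"
    and A: "covers (intermediate_groups G H) A K" and B: "covers (intermediate_groups G H) B K"
    and "A \<noteq> B"
  shows "covers (intermediate_groups G H) (A \<inter> B) B"
    and "subgroup_index G K A = subgroup_index G B (A \<inter> B)"
proof -
  let ?S = "intermediate_groups G H"
  have S: "A \<in> ?S" "B \<in> ?S" "K \<in> ?S" "A \<subset> K" "B \<subset> K"
    and maxA: "\<And>C. C \<in> ?S \<Longrightarrow> A \<subseteq> C \<Longrightarrow> C \<subseteq> K \<Longrightarrow> C = A \<or> C = K"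
    and maxB: "\<And>C. C \<in> ?S \<Longrightarrow> B \<subseteq> C \<Longrightarrow> C \<subseteq> K \<Longrightarrow> C = B \<or> C = K"
    using A B by (auto simp: covers_def)
  then have sub: "subgroup A G" "subgroup B G" "subgroup K G"
    by (auto simp: intermediate_groups_def)
  have prod: "D <#> A = A \<or> D <#> A = K" if D: "D \<in> ?S" "D \<subseteq> K" for D
  proof -
    have "subgroup D G" using D by (simp add: intermediate_groups_def)
    then have "subgroup (D <#> A) G" "A \<subseteq> D <#> A"
      using subgroup_set_mult_permutable[OF _ sub(1) perm[OF D(1) S(1)]] subset_set_mult(2)[OF _ sub(1)]
      by blast+
    moreover have "D <#> A \<subseteq> K"
      using S D by (intro set_mult_subgroup_subset[OF sub(3)]) auto
    ultimately show ?thesis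
      using maxA[of "D <#> A"] S(1) by (auto simp: intermediate_groups_def)
  qed
  have "\<not> B \<subseteq> A" using maxB[OF S(1)] S \<open>A \<noteq> B\<close> by auto
  then have "B <#> A \<noteq> A" using subset_set_mult(1)[OF sub(2,1)] by auto
  then have "A <#> B = K" using prod[OF S(2)] S perm[OF S(1,2)] by auto
  then show "subgroup_index G K A = subgroup_index G B (A \<inter> B)"
    using subgroup_index_set_mult[OF sub(1,2)] by simp
  show "covers ?S (A \<inter> B) B"
    unfolding covers_def
  proof (intro conjI ballI impI)
    show "A \<inter> B \<in> ?S"
      using S subgroups_Inter_pair[OF sub(1,2)] by (auto simp: intermediate_groups_def)
    show "B \<in> ?S" "A \<inter> B \<subset> B" using S \<open>\<not> B \<subseteq> A\<close> by auto
    fix D assume D: "D \<in> ?S" "A \<inter> B \<subseteq> D" "D \<subseteq> B"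
    then have subD: "subgroup D G" by (simp add: intermediate_groups_def)
    have "B \<inter> (D <#> A) = D <#> (B \<inter> A)"
      using dedekind_modular_law[OF sub(2) D(3) sub(1)] .
    also have "\<dots> = D"
      using D(2) set_mult_subgroup_subset[OF subD order_refl, of "B \<inter> A"]
        subset_set_mult(1)[OF subD subgroups_Inter_pair[OF sub(2,1)]] by blast
    finally have "D = B \<inter> (D <#> A)" ..
    moreover have "D <#> A = A \<or> D <#> A = K"
      using prod[OF D(1)] D(3) S(5) by blast
    ultimately show "D = A \<inter> B \<or> D = B"
      using S(5) by auto
  qed
qed

theorem jordan_property_of_permutable:
  assumes H: "subgroup H G" and "finite (rcosets H)" and fin: "finite (intermediate_groups G H)"
    and perm: "\<And>A B. A \<in> intermediate_groups G H \<Longrightarrow> B \<in> intermediate_groups G H \<Longrightarrow>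
      A <#> B = B <#> A"
  shows "jordan_property G H"
  unfolding jordan_property_def
proof (intro conjI allI impI H \<open>finite (rcosets H)\<close>)
  let ?S = "intermediate_groups G H"
  let ?w = "\<lambda>A B. subgroup_index G B A"
  have bot: "H \<in> ?S" "\<And>K. K \<in> ?S \<Longrightarrow> H \<subseteq> K" and top: "carrier G \<in> ?S" "\<And>K. K \<in> ?S \<Longrightarrow> K \<subseteq> carrier G"
    using H subgroup_self subgroup.subset by (auto simp: intermediate_groups_def)
  have chain: "chain_weights ?S ?w H (carrier G) (mset (index_sequence G As)) \<and> As \<noteq> []"
    if "maximal_group_chain G H As" for As
    using that chain_weights_maxchain(1)[OF _ _ bot top]
      chain_weights_maxchain(2)[OF _ _ bot top, where w = ?w]
    unfolding maximal_group_chain_def index_sequence_def by blast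
  fix As Bs assume "maximal_group_chain G H As" "maximal_group_chain G H Bs"
  note As = chain[OF this(1)] and Bs = chain[OF this(2)]
  show eq: "mset (index_sequence G As) = mset (index_sequence G Bs)"
    by (rule chain_weights_unique[OF fin bot _ conjunct1[OF As] conjunct1[OF Bs]])
      (auto intro: permutable_exchange[OF perm])
  have "length As - 1 = length Bs - 1"
    using mset_eq_length[OF eq] by (simp add: index_sequence_def)
  then show "length As = length Bs"
    using As Bs by (cases As; cases Bs) auto
qed

section \<open>Products with a finite group of permutable subgroups\<close>

text \<open>
  The modular law splits off \<open>H\<close> on the left, as \<open>K = K \<inter> H I = H (K \<inter> I)\<close>. The opposite order is
  the one that lets \<open>H\<close> be absorbed by a second intermediate group on the right; it is available
  because a product of two subgroups that is a group is invariant under inversion.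
\<close>

lemma intermediate_group_factorization:
  assumes H: "subgroup H G" and I: "subgroup I G" and G: "carrier G = H <#> I"
    and K: "K \<in> intermediate_groups G H"
  shows "K = (K \<inter> I) <#> H"
proof -
  have sub: "subgroup K G" "H \<subseteq> K" using K by (auto simp: intermediate_groups_def)
  have KHI: "K = H <#> (K \<inter> I)"
    using dedekind_modular_law[OF sub I] subgroup.subset[OF sub(1)] G by auto
  then show ?thesis
    using set_mult_subgroup_commute[OF H subgroups_Inter_pair[OF sub(1) I]] sub(1) by simp
qed

text \<open>
  The right-hand side of \<open>A B = (A \<inter> I) (B \<inter> I) H\<close> does not change when \<open>A\<close> and \<open>B\<close> are swapped,
  since its first two factors are subgroups of \<open>I\<close>.
\<close>

lemma intermediate_groups_permutable:
  assumes H: "subgroup H G" and I: "subgroup I G" and G: "carrier G = H <#> I"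
    and perm: "\<And>I1 I2. subgroup I1 (G\<lparr>carrier := I\<rparr>) \<Longrightarrow> subgroup I2 (G\<lparr>carrier := I\<rparr>) \<Longrightarrow>
           I1 <#> I2 = I2 <#> I1"
    and K: "K1 \<in> intermediate_groups G H" "K2 \<in> intermediate_groups G H"
  shows "K1 <#> K2 = K2 <#> K1"
proof -
  have prod: "A <#> B = (A \<inter> I) <#> (B \<inter> I) <#> H"
    if A: "A \<in> intermediate_groups G H" and B: "B \<in> intermediate_groups G H" for A B
  proof -
    have sub: "subgroup A G" "subgroup B G" "H \<subseteq> B"
      using A B by (auto simp: intermediate_groups_def)
    note car = subgroup.subset[OF H] subgroup.subset[OF I] subgroup.subset[OF sub(1)]
      subgroup.subset[OF sub(2)]
    have "A <#> B = (A \<inter> I) <#> H <#> B"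
      using intermediate_group_factorization[OF H I G A] by simp
    also have "\<dots> = (A \<inter> I) <#> B"
      using set_mult_absorb[OF H sub(2,3)] set_mult_assoc[of "A \<inter> I" H B] car by auto
    also have "\<dots> = (A \<inter> I) <#> ((B \<inter> I) <#> H)"
      using intermediate_group_factorization[OF H I G B] by simp
    also have "\<dots> = (A \<inter> I) <#> (B \<inter> I) <#> H"
      using set_mult_assoc[of "A \<inter> I" "B \<inter> I" H] car by auto
    finally show ?thesis .
  qed
  have "subgroup (A \<inter> I) (G\<lparr>carrier := I\<rparr>)" if "A \<in> intermediate_groups G H" for A
    using that I by (intro subgroup_incl subgroups_Inter_pair) (auto simp: intermediate_groups_def)
  then show ?thesis
    using prod K perm by simp
qed

end

theorem proposition1p2:
  fixes G :: "('a, 'b) monoid_scheme" and H I :: "'a set"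
  assumes "group G"
    and "subgroup H G"
    and "subgroup I G" and "finite I"
    and "carrier G = H <#>\<^bsub>G\<^esub> I"
    and "\<And>I1 I2. subgroup I1 (G\<lparr>carrier := I\<rparr>) \<Longrightarrow> subgroup I2 (G\<lparr>carrier := I\<rparr>) \<Longrightarrow>
           I1 <#>\<^bsub>G\<^esub> I2 = I2 <#>\<^bsub>G\<^esub> I1"
  shows "jordan_property G H"
proof -
  interpret group G by fact
  note H = assms(2) and I = assms(3) and G = assms(5)
  show ?thesis
  proof (rule jordan_property_of_permutable[OF H])
    have "H #>\<^bsub>G\<^esub> x \<in> (\<lambda>i. H #>\<^bsub>G\<^esub> i) ` I" if x: "x \<in> carrier G" for x
    proof -
      obtain h i where hi: "h \<in> H" "i \<in> I" "x = h \<otimes>\<^bsub>G\<^esub> i"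
        using x G by (auto elim: set_multE)
      then have "H #>\<^bsub>G\<^esub> x = H #>\<^bsub>G\<^esub> i"
        using coset_mult_assoc[of H h i] coset_join2[of h H] subgroup.subset[OF H]
          subgroup.subset[OF I] H by auto
      then show ?thesis using hi by blast
    qed
    then have "rcosets\<^bsub>G\<^esub> H \<subseteq> (\<lambda>i. H #>\<^bsub>G\<^esub> i) ` I"
      by (auto simp: RCOSETS_def)
    then show "finite (rcosets\<^bsub>G\<^esub> H)"
      using \<open>finite I\<close> finite_surj by blast
    have "inj_on (\<lambda>K. K \<inter> I) (intermediate_groups G H)"
    proof (rule inj_on_inverseI)
      show "(K \<inter> I) <#>\<^bsub>G\<^esub> H = K" if "K \<in> intermediate_groups G H" for K
        using intermediate_group_factorization[OF H I G that] ..
    qed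
    moreover have "(\<lambda>K. K \<inter> I) ` intermediate_groups G H \<subseteq> Pow I"
      by auto
    ultimately show "finite (intermediate_groups G H)"
      using \<open>finite I\<close> by (blast intro: inj_on_finite)
  next
    fix A B assume AB: "A \<in> intermediate_groups G H" "B \<in> intermediate_groups G H"
    show "A <#>\<^bsub>G\<^esub> B = B <#>\<^bsub>G\<^esub> A"
      by (rule intermediate_groups_permutable[OF H I G _ AB]) (rule assms(6))
  qed
qed

end
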